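(* Let $\mathcal{M} = \langle \mathcal{S},\mathcal{A},\tau,\mu_0,\_,\gamma\rangle$ be an environment, and let $f^{\mathcal{M}}\in F^{\mathcal{M}}$ be surjective onto $\Pi^+$. Then $f^{\mathcal{M}}$ is $\mathrm{OPT}^{\mathcal{M}}$-robust to misspecification with $g$ if and only if $g\in F^{\mathcal{M}}$ and $g\neq f^{\mathcal{M}}$.
   Context: $\mathcal{S}$ (states) and $\mathcal{A}$ (actions) are finite sets; $\tau$ maps each $(s,a)\in\mathcal{S}\times\mathcal{A}$ to a probability distribution on $\mathcal{S}$; $\mu_0$ is a probability distribution on $\mathcal{S}$; $\gamma\in(0,1]$ is the discount. All states are assumed reachable under $\tau$ and $\mu_0$. $\mathcal{R}$ is the set of all functions $R:\mathcal{S}\times\mathcal{A}\times\mathcal{S}\to\mathbb{R}$. A policy $\pi$ maps each state to a probability distribution on $\mathcal{A}$. Value functions are expected discounted sums $\sum_t\gamma^tR(s_t,a_t,s_{t+1})$, taken to be well-defined real numbers; $Q^\star$ denotes the optimal $Q$-function of the MDP $\langle \mathcal{S},\mathcal{A},\tau,\mu_0,R,\gamma\rangle$ (and $Q_i^\star$ that for $R_i$). A policy is optimal if and only if, in every state $s$, it only gives support to actions in $\mathrm{argmax}_{a\in\mathcal{A}}Q^\star(s,a)$. $\Pi^+$ is the set of all policies with $\pi(a\mid s)>0$ for all $s,a$. $F^{\mathcal{M}}$ is the set of all functions $f:\mathcal{R}\to\Pi^+$ such that for every $R\in\mathcal{R}$, the policy $\pi=f(R)$ satisfies $\mathrm{argmax}_{a\in\mathcal{A}}\pi(a\mid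 s)=\mathrm{argmax}_{a\in\mathcal{A}}Q^\star(s,a)$ for every $s$, where $Q^\star$ is the optimal $Q$-function for $R$ in $\mathcal{M}$. A reward object is a function $f:\mathcal{R}\to X$ for some set $X$ (here $g$ ranges over reward objects). Given an equivalence relation (partition) $P$ on $\mathcal{R}$: $f$ is $P$-admissible if $f(R_1)=f(R_2)\Rightarrow R_1\equiv_P R_2$; $f$ is $P$-robust to misspecification with $g$ if $f$ is $P$-admissible, $f\neq g$, $\mathrm{Im}(g)\subseteq\mathrm{Im}(f)$, and $f(R_1)=g(R_2)\Rightarrow R_1\equiv_P R_2$ for all $R_1,R_2\in\mathcal{R}$. $R_1\equiv_{\mathrm{OPT}^{\mathcal{M}}}R_2$ means that $\langle \mathcal{S},\mathcal{A},\tau,\mu_0,R_1,\gamma\rangle$ and $\langle \mathcal{S},\mathcal{A},\tau,\mu_0,R_2,\gamma\rangle$ have the same set of optimal policies. *)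

theory Defs
  imports "HOL-Probability.Probability"
begin

text \<open>
  States and actions are the elements of types \<^typ>\<open>'s\<close> and \<^typ>\<open>'a\<close> of class \<^class>\<open>finite\<close>.
  Rewards are arbitrary functions, so the set of all rewards is the whole type.
\<close>

type_synonym ('s, 'a) transition = "'s \<Rightarrow> 'a \<Rightarrow> 's pmf"
type_synonym ('s, 'a) reward = "'s \<Rightarrow> 'a \<Rightarrow> 's \<Rightarrow> real"
type_synonym ('s, 'a) policy = "'s \<Rightarrow> 'a pmf"

definition all_states_reachable :: "('s, 'a) transition \<Rightarrow> 's pmf \<Rightarrow> bool" where
  "all_states_reachable \<tau> \<mu>\<^sub>0 \<longleftrightarrow>
    (\<forall>s. \<exists>s\<^sub>0\<in>set_pmf \<mu>\<^sub>0. (s\<^sub>0, s) \<in> {(x, y). \<exists>a. y \<in> set_pmf (\<tau> x a)}\<^sup>*)"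


subsection \<open>Trajectories and value functions\<close>

text \<open>
  A trajectory is the sequence of state-action pairs visited. Its law, when the first pair
  is \<open>p\<close> and the policy \<open>\<pi>\<close> is followed afterwards, is given by the theorem of Ionescu-Tulcea.
  The coordinate \<open>n\<close> of the kernel is the law of the \<open>n\<close>-th pair given the earlier ones.
\<close>

definition traj_kernel ::
  "('s, 'a) transition \<Rightarrow> ('s, 'a) policy \<Rightarrow> 's \<times> 'a \<Rightarrow> nat \<Rightarrow> (nat \<Rightarrow> 's \<times> 'a) \<Rightarrow> ('s \<times> 'a) measure"
where
  "traj_kernel \<tau> \<pi> p n \<omega> =
    measure_pmf (case n of
        0 \<Rightarrow> return_pmf p
      | Suc m \<Rightarrow> do {
          s' \<leftarrow> \<tau> (fst (\<omega> m)) (snd (\<omega> m));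
          a' \<leftarrow> \<pi> s';
          return_pmf (s', a')
        })"

lemma Ionescu_Tulcea_traj_kernel:
  fixes \<tau> :: "('s::finite, 'a::finite) transition"
  shows "Ionescu_Tulcea (traj_kernel \<tau> \<pi> p) (\<lambda>_. count_space UNIV)"
proof (rule Ionescu_Tulcea.intro)
  fix n
  show "traj_kernel \<tau> \<pi> p n \<in>
      measurable (PiM {0..<n} (\<lambda>_. count_space UNIV)) (subprob_algebra (count_space UNIV))"
  proof (cases n)
    case 0
    then show ?thesis
      by (simp add: traj_kernel_def[abs_def] space_subprob_algebra prob_space_imp_subprob_space
          measure_pmf.prob_space_axioms)
  next
    case (Suc m)
    let ?K = "\<lambda>q. measure_pmf (do {s' \<leftarrow> \<tau> (fst q) (snd q); a' \<leftarrow> \<pi> s'; return_pmf (s', a')})"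
    have K: "?K \<in> measurable (count_space UNIV) (subprob_algebra (count_space UNIV))"
      by (simp add: space_subprob_algebra prob_space_imp_subprob_space measure_pmf.prob_space_axioms)
    have "(\<lambda>\<omega>. \<omega> m) \<in> measurable (PiM {0..<n} (\<lambda>_. count_space (UNIV :: ('s \<times> 'a) set))) (count_space UNIV)"
      using Suc by (intro measurable_component_singleton) auto
    from measurable_compose[OF this K] show ?thesis
      using Suc by (simp add: traj_kernel_def[abs_def])
  qed
next
  fix n \<omega>
  show "prob_space (traj_kernel \<tau> \<pi> p n \<omega>)"
    by (simp add: traj_kernel_def measure_pmf.prob_space_axioms)
qed

definition trajectories ::
  "('s, 'a) transition \<Rightarrow> ('s, 'a) policy \<Rightarrow> 's \<times> 'a \<Rightarrow> (nat \<Rightarrow> 's \<times> 'a) measure"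
where
  "trajectories \<tau> \<pi> p =
    projective_family.lim UNIV
      (Ionescu_Tulcea.CI (traj_kernel \<tau> \<pi> p) (\<lambda>_. count_space UNIV)) (\<lambda>_. count_space UNIV)"

definition step_return :: "('s, 'a) reward \<Rightarrow> real \<Rightarrow> (nat \<Rightarrow> 's \<times> 'a) \<Rightarrow> nat \<Rightarrow> real" where
  "step_return R \<gamma> \<omega> t = \<gamma> ^ t * R (fst (\<omega> t)) (snd (\<omega> t)) (fst (\<omega> (Suc t)))"

definition Q_value ::
  "('s, 'a) transition \<Rightarrow> real \<Rightarrow> ('s, 'a) reward \<Rightarrow> ('s, 'a) policy \<Rightarrow> 's \<Rightarrow> 'a \<Rightarrow> real"
where
  "Q_value \<tau> \<gamma> R \<pi> s a = (LINT \<omega>|trajectories \<tau> \<pi> (s, a). (\<Sum>t. step_return R \<gamma> \<omega> t))"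

text \<open>
  The default values of divergent series and of non-integrable functions are excluded by the
  next condition, which ranges over all rewards. It holds for every discount below 1, and
  fails for discount 1 (see \<open>values_well_defined_iff\<close> below), since there are no terminal states.
\<close>

definition values_well_defined :: "('s, 'a) transition \<Rightarrow> real \<Rightarrow> bool" where
  "values_well_defined \<tau> \<gamma> \<longleftrightarrow>
    (\<forall>R \<pi> p. (AE \<omega> in trajectories \<tau> \<pi> p. summable (step_return R \<gamma> \<omega>)) \<and>
      integrable (trajectories \<tau> \<pi> p) (\<lambda>\<omega>. \<Sum>t. step_return R \<gamma> \<omega> t))"

definition Q_star :: "('s, 'a) transition \<Rightarrow> real \<Rightarrow> ('s, 'a) reward \<Rightarrow> 's \<Rightarrow> 'a \<Rightarrow> real" where
  "Q_star \<tau> \<gamma> R s a = (SUP \<pi>. Q_value \<tau> \<gamma> R \<pi> s a)"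


subsection \<open>Optimal policies and reward objects\<close>

definition argmax :: "('a \<Rightarrow> real) \<Rightarrow> 'a set" where
  "argmax h = {a. is_arg_max h (\<lambda>_. True) a}"

definition optimal_policies ::
  "('s, 'a) transition \<Rightarrow> real \<Rightarrow> ('s, 'a) reward \<Rightarrow> ('s, 'a) policy set"
where
  "optimal_policies \<tau> \<gamma> R = {\<pi>. \<forall>s. set_pmf (\<pi> s) \<subseteq> argmax (Q_star \<tau> \<gamma> R s)}"

definition OPT :: "('s, 'a) transition \<Rightarrow> real \<Rightarrow> ('s, 'a) reward rel" where
  "OPT \<tau> \<gamma> = {(R\<^sub>1, R\<^sub>2). optimal_policies \<tau> \<gamma> R\<^sub>1 = optimal_policies \<tau> \<gamma> R\<^sub>2}"

definition positive_policies :: "('s, 'a) policy set" where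
  "positive_policies = {\<pi>. \<forall>s a. pmf (\<pi> s) a > 0}"

definition F_class ::
  "('s, 'a) transition \<Rightarrow> real \<Rightarrow> (('s, 'a) reward \<Rightarrow> ('s, 'a) policy) set"
where
  "F_class \<tau> \<gamma> = {f. \<forall>R. f R \<in> positive_policies \<and>
      (\<forall>s. argmax (pmf (f R s)) = argmax (Q_star \<tau> \<gamma> R s))}"

definition admissible :: "'r rel \<Rightarrow> ('r \<Rightarrow> 'x) \<Rightarrow> bool" where
  "admissible P f \<longleftrightarrow> (\<forall>R\<^sub>1 R\<^sub>2. f R\<^sub>1 = f R\<^sub>2 \<longrightarrow> (R\<^sub>1, R\<^sub>2) \<in> P)"

definition robust_to_misspecification :: "'r rel \<Rightarrow> ('r \<Rightarrow> 'x) \<Rightarrow> ('r \<Rightarrow> 'x) \<Rightarrow> bool" where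
  "robust_to_misspecification P f g \<longleftrightarrow>
    admissible P f \<and> f \<noteq> g \<and> range g \<subseteq> range f \<and>
    (\<forall>R\<^sub>1 R\<^sub>2. f R\<^sub>1 = g R\<^sub>2 \<longrightarrow> (R\<^sub>1, R\<^sub>2) \<in> P)"


subsection \<open>Consistency of the definitions\<close>

lemma equiv_OPT: "equiv UNIV (OPT \<tau> \<gamma>)"
  by (auto simp: OPT_def equiv_def refl_on_def sym_def trans_def)

context
  fixes \<tau> :: "('s::finite, 'a::finite) transition"
begin

lemma sets_trajectories:
  "sets (trajectories \<tau> \<pi> p) = sets (PiM UNIV (\<lambda>_. count_space UNIV))"
proof -
  interpret IT: Ionescu_Tulcea "traj_kernel \<tau> \<pi> p" "\<lambda>_. count_space UNIV"
    by (rule Ionescu_Tulcea_traj_kernel)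
  show ?thesis by (simp add: trajectories_def)
qed

lemma prob_space_trajectories: "prob_space (trajectories \<tau> \<pi> p)"
proof -
  interpret IT: Ionescu_Tulcea "traj_kernel \<tau> \<pi> p" "\<lambda>_. count_space UNIV"
    by (rule Ionescu_Tulcea_traj_kernel)
  have "emeasure IT.PF.lim (IT.PF.emb UNIV {} (space (PiM {} (\<lambda>_. count_space UNIV)))) = 1"
    using prob_space.emeasure_space_1[OF IT.PF.prob_space_P[of "{}"]]
    by (subst IT.lim) (simp_all add: IT.PF.space_P)
  then have "prob_space IT.PF.lim"
    by (intro prob_spaceI) (simp add: prod_emb_def space_PiM restrict_def vimage_def)
  then show ?thesis by (simp add: trajectories_def)
qed

lemma step_return_bound:
  fixes R :: "('s, 'a) reward"
  assumes "0 < \<gamma>" and "\<gamma> < 1"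
  shows "\<exists>B. \<forall>\<omega>. summable (step_return R \<gamma> \<omega>) \<and> \<bar>\<Sum>t. step_return R \<gamma> \<omega> t\<bar> \<le> B"
proof -
  define B where "B = (\<Sum>(x, y, z)\<in>UNIV. \<bar>R (x::'s) (y::'a) z\<bar>)"
  have R: "\<bar>R x y z\<bar> \<le> B" for x y z
    using member_le_sum[of "(x, y, z)" UNIV "\<lambda>(x, y, z). \<bar>R x y z\<bar>"] by (auto simp: B_def)
  have le: "norm (step_return R \<gamma> \<omega> t) \<le> B * \<gamma> ^ t" for \<omega> t
    using R assms by (simp add: step_return_def abs_mult mult.commute mult_right_mono)
  have sm: "summable (\<lambda>t. B * \<gamma> ^ t)"
    using assms by (intro summable_mult summable_geometric) auto
  have "summable (step_return R \<gamma> \<omega>)" for \<omega>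
    by (rule summable_comparison_test'[OF sm]) (rule le)
  moreover have "\<bar>\<Sum>t. step_return R \<gamma> \<omega> t\<bar> \<le> (\<Sum>t. B * \<gamma> ^ t)" for \<omega>
    using norm_suminf_le[OF le sm] by simp
  ultimately show ?thesis by blast
qed

lemma measurable_step_return:
  "(\<lambda>\<omega>. step_return R \<gamma> \<omega> t) \<in> borel_measurable (trajectories \<tau> \<pi> p)"
proof -
  let ?M = "PiM UNIV (\<lambda>_::nat. count_space (UNIV :: ('s \<times> 'a) set))"
  have c: "(\<lambda>\<omega>. \<omega> i) \<in> measurable ?M (count_space UNIV)" for i
    by (rule measurable_component_singleton) simp
  have "(\<lambda>\<omega>. step_return R \<gamma> \<omega> t) \<in> borel_measurable ?M"
    unfolding step_return_def
    by (rule measurable_compose_countable[OF _ c[of t],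
          where f = "\<lambda>q \<omega>. \<gamma> ^ t * R (fst q) (snd q) (fst (\<omega> (Suc t)))"])
      (rule measurable_compose[OF c], simp)
  then show ?thesis
    by (simp cong: measurable_cong_sets add: sets_trajectories)
qed

lemma integrable_return:
  assumes "0 < \<gamma>" and "\<gamma> < 1"
  shows "integrable (trajectories \<tau> \<pi> p) (\<lambda>\<omega>. \<Sum>t. step_return R \<gamma> \<omega> t)"
proof -
  interpret prob_space "trajectories \<tau> \<pi> p" by (rule prob_space_trajectories)
  obtain B where "\<forall>\<omega>::nat \<Rightarrow> 's \<times> 'a. \<bar>\<Sum>t. step_return R \<gamma> \<omega> t\<bar> \<le> B"
    using step_return_bound[OF assms] by blast
  then show ?thesis
    by (intro integrable_const_bound[where B = B] borel_measurable_suminf measurable_step_return) auto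
qed

lemma values_well_defined_iff:
  assumes "0 < \<gamma>" and "\<gamma> \<le> 1"
  shows "values_well_defined \<tau> \<gamma> \<longleftrightarrow> \<gamma> < 1"
proof
  assume "\<gamma> < 1"
  with assms show "values_well_defined \<tau> \<gamma>"
    unfolding values_well_defined_def using step_return_bound[of \<gamma>] integrable_return[of \<gamma>]
    by (metis (mono_tags, lifting) AE_I2)
next
  assume wd: "values_well_defined \<tau> \<gamma>"
  show "\<gamma> < 1"
  proof (rule ccontr)
    assume "\<not> \<gamma> < 1"
    with assms have "\<gamma> = 1" by simp
    fix \<pi> :: "('s, 'a) policy" and p
    interpret prob_space "trajectories \<tau> \<pi> p" by (rule prob_space_trajectories)
    have "AE \<omega> in trajectories \<tau> \<pi> p. summable (step_return (\<lambda>_ _ _. 1) \<gamma> \<omega>)"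
      using wd unfolding values_well_defined_def by blast
    then have "AE \<omega> in trajectories \<tau> \<pi> p. False"
      by (simp add: step_return_def[abs_def] \<open>\<gamma> = 1\<close> summable_const_iff)
    then show False by simp
  qed
qed

lemma bdd_above_Q_value:
  assumes "0 < \<gamma>" and "\<gamma> < 1"
  shows "bdd_above (range (\<lambda>\<pi>. Q_value \<tau> \<gamma> R \<pi> s a))"
proof -
  obtain B where B: "\<forall>\<omega>::nat \<Rightarrow> 's \<times> 'a. \<bar>\<Sum>t. step_return R \<gamma> \<omega> t\<bar> \<le> B"
    using step_return_bound[OF assms] by blast
  have "Q_value \<tau> \<gamma> R \<pi> s a \<le> B" for \<pi>
  proof -
    interpret prob_space "trajectories \<tau> \<pi> (s, a)" by (rule prob_space_trajectories)
    show ?thesis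
      unfolding Q_value_def using B
      by (intro integral_le_const integrable_return assms) (auto simp: abs_le_iff)
  qed
  then show ?thesis by (auto simp: bdd_above_def)
qed

end

end

theory Submission
  imports Defs
begin

text \<open>The set of optimal policies of a reward and the family of its sets of optimal actions,
  one per state, determine each other; so \<open>OPT\<close> relates two rewards exactly when these
  families agree (\<open>OPT_iff_argmax_Q_star_eq\<close>). A member of \<open>F_class\<close>
  records the family in the most likely actions of its policy. Hence equal values of two members
  force equivalent rewards (\<open>F_class_eq_imp_OPT\<close>), which gives robustness once
  surjectivity of \<open>f\<close> supplies the image inclusion. Conversely, robustness writes each
  \<open>g R\<close> as some \<open>f R'\<close> with \<open>R'\<close> equivalent to
  \<open>R\<close>, so \<open>g R\<close> records the family of \<open>R\<close> as well.\<close>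

lemma argmax_nonempty:
  fixes h :: "'a::finite \<Rightarrow> real"
  shows "argmax h \<noteq> {}"
proof -
  have "finite (range h)" "range h \<noteq> {}" by auto
  then obtain a where "h a = Max (range h)"
    by (metis Max_in imageE)
  then have "a \<in> argmax h"
    by (simp add: argmax_def is_arg_max_linorder)
  then show ?thesis by blast
qed

text \<open>Optimality is a separate condition at each state, so any optimal action at
  \<open>s\<close> extends to an optimal policy. This recovers the optimal actions from the optimal
  policies alone.\<close>

lemma argmax_Q_star_eq_UN_optimal_policies:
  fixes \<tau> :: "('s, 'a::finite) transition"
  shows "argmax (Q_star \<tau> \<gamma> R s) = (\<Union>\<pi>\<in>optimal_policies \<tau> \<gamma> R. set_pmf (\<pi> s))"
proof
  show "(\<Union>\<pi>\<in>optimal_policies \<tau> \<gamma> R. set_pmf (\<pi> s)) \<subseteq> argmax (Q_star \<tau> \<gamma> R s)"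
    by (auto simp: optimal_policies_def)
next
  show "argmax (Q_star \<tau> \<gamma> R s) \<subseteq> (\<Union>\<pi>\<in>optimal_policies \<tau> \<gamma> R. set_pmf (\<pi> s))"
  proof
    fix a
    assume a: "a \<in> argmax (Q_star \<tau> \<gamma> R s)"
    have "\<forall>s'. \<exists>b. b \<in> argmax (Q_star \<tau> \<gamma> R s')"
      using argmax_nonempty by blast
    then obtain b where b: "b s' \<in> argmax (Q_star \<tau> \<gamma> R s')" for s'
      by metis
    \<comment> \<open>A deterministic policy that plays \<open>a\<close> at \<open>s\<close>;
      \<open>b\<close> keeps it optimal at all other states.\<close>
    have "(\<lambda>s'. return_pmf ((b(s := a)) s')) \<in> optimal_policies \<tau> \<gamma> R"
      using a b by (simp add: optimal_policies_def)
    then show "a \<in> (\<Union>\<pi>\<in>optimal_policies \<tau> \<gamma> R. set_pmf (\<pi> s))"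
      by (rule UN_I) simp
  qed
qed

lemma OPT_iff_argmax_Q_star_eq:
  fixes \<tau> :: "('s, 'a::finite) transition"
  shows "(R\<^sub>1, R\<^sub>2) \<in> OPT \<tau> \<gamma> \<longleftrightarrow>
    (\<forall>s. argmax (Q_star \<tau> \<gamma> R\<^sub>1 s) = argmax (Q_star \<tau> \<gamma> R\<^sub>2 s))"
proof
  assume "(R\<^sub>1, R\<^sub>2) \<in> OPT \<tau> \<gamma>"
  then show "\<forall>s. argmax (Q_star \<tau> \<gamma> R\<^sub>1 s) = argmax (Q_star \<tau> \<gamma> R\<^sub>2 s)"
    by (simp add: OPT_def argmax_Q_star_eq_UN_optimal_policies)
qed (simp add: OPT_def optimal_policies_def)

text \<open>The common policy can be decoded in two ways: through \<open>f\<close> its most likely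
  actions are the optimal ones for the first reward, through \<open>g\<close> for the
  second.\<close>

lemma F_class_eq_imp_OPT:
  fixes \<tau> :: "('s, 'a::finite) transition"
  assumes "f \<in> F_class \<tau> \<gamma>" and "g \<in> F_class \<tau> \<gamma>" and "f R\<^sub>1 = g R\<^sub>2"
  shows "(R\<^sub>1, R\<^sub>2) \<in> OPT \<tau> \<gamma>"
  unfolding OPT_iff_argmax_Q_star_eq
proof
  fix s
  have "argmax (Q_star \<tau> \<gamma> R\<^sub>1 s) = argmax (pmf (f R\<^sub>1 s))"
    using assms(1) by (simp add: F_class_def)
  also have "\<dots> = argmax (Q_star \<tau> \<gamma> R\<^sub>2 s)"
    using assms(2,3) by (simp add: F_class_def)
  finally show "argmax (Q_star \<tau> \<gamma> R\<^sub>1 s) = argmax (Q_star \<tau> \<gamma> R\<^sub>2 s)" .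
qed

theorem theorem3p1:
  fixes \<tau> :: "('s::finite, 'a::finite) transition"
    and \<mu>\<^sub>0 :: "'s pmf"
    and \<gamma> :: real
    and f g :: "('s, 'a) reward \<Rightarrow> ('s, 'a) policy"
  assumes "0 < \<gamma>" and "\<gamma> \<le> 1"
    and "all_states_reachable \<tau> \<mu>\<^sub>0"
    and "values_well_defined \<tau> \<gamma>"
    and "f \<in> F_class \<tau> \<gamma>"
    and "range f = positive_policies"
  shows "robust_to_misspecification (OPT \<tau> \<gamma>) f g \<longleftrightarrow> g \<in> F_class \<tau> \<gamma> \<and> g \<noteq> f"
proof
  assume robust: "robust_to_misspecification (OPT \<tau> \<gamma>) f g"
  have "g R \<in> positive_policies \<and> (\<forall>s. argmax (pmf (g R s)) = argmax (Q_star \<tau> \<gamma> R s))" for R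
  proof -
    have "g R \<in> range f"
      using robust by (auto simp: robust_to_misspecification_def)
    then obtain R' where R': "f R' = g R"
      by (metis imageE)
    then have "(R', R) \<in> OPT \<tau> \<gamma>"
      using robust by (simp add: robust_to_misspecification_def)
    moreover have "f R' \<in> positive_policies"
      and "argmax (pmf (f R' s)) = argmax (Q_star \<tau> \<gamma> R' s)" for s
      using \<open>f \<in> F_class \<tau> \<gamma>\<close> by (simp_all add: F_class_def)
    ultimately show ?thesis
      \<comment> \<open>Both properties of \<open>f R'\<close> pass to \<open>g R\<close>, and
        equivalence replaces the optimal actions of \<open>R'\<close> by those of
        \<open>R\<close>.\<close>
      by (simp add: OPT_iff_argmax_Q_star_eq R')
  qed
  then show "g \<in> F_class \<tau> \<gamma> \<and> g \<noteq> f"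
    using robust by (auto simp: F_class_def robust_to_misspecification_def)
next
  assume g: "g \<in> F_class \<tau> \<gamma> \<and> g \<noteq> f"
  then have "range g \<subseteq> range f"
    using \<open>range f = positive_policies\<close> by (auto simp: F_class_def)
  \<comment> \<open>\<open>F_class_eq_imp_OPT\<close> serves twice: with \<open>f\<close> in both
    roles for admissibility, and with \<open>f\<close> and \<open>g\<close> for the last
    condition.\<close>
  with g show "robust_to_misspecification (OPT \<tau> \<gamma>) f g"
    using \<open>f \<in> F_class \<tau> \<gamma>\<close>
    by (auto simp: robust_to_misspecification_def admissible_def intro: F_class_eq_imp_OPT)
qed

end
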